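(* Let $r_0,r_1,\dots,r_n>0$. Then there exists a unique system of points $0=w_0<w_1<\dots<w_n<2\pi$ such that \[\Big\|\prod_{j=0}^n\Big|\sin\frac{t-w_j}{2}\Big|^{r_j}\Big\|=\inf_{0=y_0\le y_1\le\dots\le y_n\le2\pi}\Big\|\prod_{j=0}^n\Big|\sin\frac{t-y_j}{2}\Big|^{r_j}\Big\|,\] where $\|\cdot\|$ is the sup-norm over $t\in[0,2\pi]$. The extremal generalized trigonometric polynomial $T^*(t)=\prod_{j=0}^n|\sin\frac{t-w_j}{2}|^{r_j}$ is uniquely determined by the property that there exist $0<z_0<z_1<\dots<z_n<2\pi$ interlacing with the $w_j$'s, i.e. $0=w_0<z_0<w_1<z_1<\dots<w_n<z_n<2\pi$, such that $T^*(z_j)=\|T^*\|$ for $j=0,1,\dots,n$. *)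

theory Defs
  imports Complex_Main
begin

definition gtp :: "(nat \<Rightarrow> real) \<Rightarrow> real list \<Rightarrow> real \<Rightarrow> real" where
  "gtp r ys t = (\<Prod>j<length ys. \<bar>sin ((t - ys ! j) / 2)\<bar> powr r j)"

definition supnorm :: "(real \<Rightarrow> real) \<Rightarrow> real" where
  "supnorm f = (SUP t\<in>{0..2*pi}. \<bar>f t\<bar>)"

definition admissible :: "nat \<Rightarrow> real list \<Rightarrow> bool" where
  "admissible n ys \<longleftrightarrow> length ys = Suc n \<and> ys ! 0 = 0 \<and>
     (\<forall>j<n. ys ! j \<le> ys ! Suc j) \<and> ys ! n \<le> 2*pi"

definition strict_nodes :: "nat \<Rightarrow> real list \<Rightarrow> bool" where
  "strict_nodes n ws \<longleftrightarrow> length ws = Suc n \<and> ws ! 0 = 0 \<and>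
     (\<forall>j<n. ws ! j < ws ! Suc j) \<and> ws ! n < 2*pi"

definition min_norm :: "(nat \<Rightarrow> real) \<Rightarrow> nat \<Rightarrow> real" where
  "min_norm r n = (INF ys\<in>{ys. admissible n ys}. supnorm (gtp r ys))"

definition interlacing :: "nat \<Rightarrow> real list \<Rightarrow> real list \<Rightarrow> bool" where
  "interlacing n ws zs \<longleftrightarrow> length zs = Suc n \<and>
     (\<forall>j\<le>n. ws ! j < zs ! j) \<and> (\<forall>j<n. zs ! j < ws ! Suc j) \<and> zs ! n < 2*pi"

end

theory Submission
  imports Defs "HOL-Analysis.Analysis"
begin

text \<open>
  A minimizer exists by compactness. If the maximum of a minimizer were not attained on some arc
  between consecutive nodes (possibly a degenerate one), push the two end nodes of the arc apart by
  distances inversely proportional to their weights: since \<open>ln (sin (x/2))\<close> is strictly concave,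
  this decreases the product everywhere outside the arc, a contradiction. So a minimizer
  equioscillates, and in particular has distinct nodes.

  Equioscillating nodes are unique: given two such systems \<open>w\<close> and \<open>y\<close>, pick an index \<open>k\<close>
  maximizing \<open>w k - y k\<close> and rotate \<open>y\<close> so that \<open>y k = w k\<close> and \<open>w i \<le> y i\<close> for all \<open>i\<close>. Then
  the quotient of the two products is strictly decreasing across the common node. Compare it at a
  maximum point of \<open>y\<close> just before this node and a maximum point of \<open>w\<close> just after it.
\<close>

section \<open>Periodic functions\<close>

lemma periodic_shift_int:
  fixes g :: "int \<Rightarrow> 'a"
  assumes "\<And>i. g (i + N) = g i"
  shows "g (i + m * N) = g i"
proof (induction m rule: int_induct[where k = 0])
  case (step1 m)
  then show ?case using assms[of "i + m * N"] by (simp add: algebra_simps)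
next
  case (step2 m)
  then show ?case using assms[of "i + (m - 1) * N"] by (simp add: algebra_simps)
qed simp

lemma periodic_mod_int:
  fixes g :: "int \<Rightarrow> 'a"
  assumes "\<And>i. g (i + N) = g i"
  shows "g (i mod N) = g i"
  using periodic_shift_int[of g N "i mod N" "i div N", OF assms] by (simp add: algebra_simps)

text \<open>Moving the window by one index trades the factor at \<open>k\<close> for the equal
  factor at \<open>k + N\<close>. This allows a product over the circle to be read starting from any
  chosen node.\<close>

lemma prod_periodic_window:
  fixes g :: "int \<Rightarrow> 'a :: comm_monoid_mult"
  assumes "\<And>i. g (i + N) = g i" "N > 0"
  shows "prod g {k..<k+N} = prod g {0..<N}"
proof -
  have *: "prod g {k+1..<k+1+N} = prod g {k..<k+N}" for k
  proof -
    have "{k+1..<k+1+N} = insert (k+N) {k+1..<k+N}" "{k..<k+N} = insert k {k+1..<k+N}"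
      using assms(2) by auto
    then show ?thesis using assms(1)[of k] by simp
  qed
  show ?thesis
  proof (induction k rule: int_induct[where k = 0])
    case (step1 k)
    then show ?case using *[of k] by simp
  next
    case (step2 k)
    then show ?case using *[of "k-1"] by simp
  qed simp
qed

lemma mono_int_step:
  fixes f :: "int \<Rightarrow> 'a :: order"
  assumes "\<And>i. f i \<le> f (i + 1)"
  shows "mono f"
proof (rule monoI)
  fix i j :: int assume "i \<le> j"
  then show "f i \<le> f j" by (induction j rule: int_ge_induct) (use assms order_trans in blast)+
qed

lemma strict_mono_int_step:
  fixes f :: "int \<Rightarrow> 'a :: order"
  assumes "\<And>i. f i < f (i + 1)"
  shows "strict_mono f"
proof (rule strict_monoI)
  fix i j :: int assume "i < j"
  then show "f i < f j" by (induction j rule: int_gr_induct) (use assms order_less_trans in blast)+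
qed

lemma periodic_representative:
  fixes f :: "real \<Rightarrow> real"
  assumes per: "\<And>t. f (t + 2*pi) = f t"
  obtains t' where "a \<le> t'" "t' < a + 2*pi" "f t' = f t"
proof -
  define m where "m = \<lfloor>(t - a) / (2*pi)\<rfloor>"
  have fm: "f (t' + 2*pi * real_of_int m) = f t'" for t' and m :: int
  proof (induction m rule: int_induct[where k = 0])
    case (step1 m)
    then show ?case using per[of "t' + 2*pi * real_of_int m"] by (simp add: algebra_simps)
  next
    case (step2 m)
    then show ?case using per[of "t' + 2*pi * real_of_int (m - 1)"] by (simp add: algebra_simps)
  qed simp
  have "real_of_int m \<le> (t - a) / (2*pi)" "(t - a) / (2*pi) < real_of_int m + 1"
    unfolding m_def by linarith+
  then have "real_of_int m * (2*pi) \<le> t - a" "t - a < (real_of_int m + 1) * (2*pi)"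
    by (simp_all add: field_simps)
  then show thesis
    using fm[of "t - 2*pi * real_of_int m" m]
    by (intro that[of "t - 2*pi * real_of_int m"]) (auto simp: algebra_simps)
qed

text \<open>Compactness of \<open>{0..2*pi}\<close> gives a maximum point there. Periodicity then
  extends the bound to the whole line and moves the maximum point into any prescribed half-open
  period.\<close>

lemma supnorm_periodic:
  fixes f :: "real \<Rightarrow> real"
  assumes per: "\<And>t. f (t + 2*pi) = f t" and cont: "continuous_on UNIV f" and nn: "\<And>t. f t \<ge> 0"
  shows supnorm_ge: "f t \<le> supnorm f"
    and supnorm_attained: "\<exists>t. a \<le> t \<and> t < a + 2*pi \<and> f t = supnorm f"
proof -
  have "compact (f ` {0..2*pi})"
    by (intro compact_continuous_image continuous_on_subset[OF cont]) auto
  moreover have "supnorm f = Sup (f ` {0..2*pi})"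
    unfolding supnorm_def using nn by simp
  ultimately have sup: "supnorm f \<in> f ` {0..2*pi}" "\<And>s. s \<in> {0..2*pi} \<Longrightarrow> f s \<le> supnorm f"
    by (auto intro!: closed_contains_Sup compact_imp_closed cSup_upper bounded_imp_bdd_above compact_imp_bounded)
  show "f t \<le> supnorm f"
  proof -
    obtain t' where "0 \<le> t'" "t' < 0 + 2*pi" "f t' = f t"
      using periodic_representative[of f 0 t] per by blast
    then show ?thesis using sup(2)[of t'] by auto
  qed
  from sup(1) obtain s where "f s = supnorm f" by auto
  then show "\<exists>t. a \<le> t \<and> t < a + 2*pi \<and> f t = supnorm f"
    using periodic_representative[of f a s] per by metis
qed

lemma supnorm_translate:
  fixes f g :: "real \<Rightarrow> real"
  assumes "\<And>t. f (t + 2*pi) = f t" "continuous_on UNIV f" "\<And>t. f t \<ge> 0"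
    and "\<And>t. g t = f (t + c)"
  shows "supnorm g = supnorm f"
proof -
  have g: "g (t + 2*pi) = g t" "g t \<ge> 0" for t
    using assms(1)[of "t + c"] assms(3)[of "t + c"] assms(4) by (simp_all add: algebra_simps)
  have cg: "continuous_on UNIV g"
    unfolding assms(4)[abs_def] by (intro continuous_on_compose2[OF assms(2)] continuous_intros) auto
  obtain a where a: "f a = supnorm f" using supnorm_attained[OF assms(1-3)] by blast
  obtain b where b: "g b = supnorm g" using supnorm_attained[OF g(1) cg g(2)] by blast
  have "f a \<le> supnorm g" using supnorm_ge[OF g(1) cg g(2), of "a - c"] assms(4)[of "a - c"] by simp
  moreover have "g b \<le> supnorm f" using supnorm_ge[OF assms(1-3), of "b + c"] assms(4)[of b] by simp
  ultimately show ?thesis using a b by simp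
qed

section \<open>Quasi-periodic node sequences\<close>

text \<open>
  Nodes on the circle are indexed by all integers, with \<open>y (i + N) = y i + 2\<pi>\<close>, so that the arc
  from the last node back to the first is not special.
\<close>

locale periodic_weights =
  fixes N :: int and r :: "int \<Rightarrow> real"
  assumes N_pos: "N > 0" and r_periodic: "r (i + N) = r i" and r_pos: "r i > 0"
begin

definition quasi_periodic :: "(int \<Rightarrow> real) \<Rightarrow> bool" where
  "quasi_periodic y \<longleftrightarrow> (\<forall>i. y (i + N) = y i + 2*pi)"

definition tp :: "(int \<Rightarrow> real) \<Rightarrow> real \<Rightarrow> real" where
  "tp y t = (\<Prod>i\<in>{0..<N}. \<bar>sin ((t - y i) / 2)\<bar> powr r i)"

text \<open>Raising the index by \<open>N\<close> moves the node by \<open>2*pi\<close>, hence the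
  half-angle by \<open>pi\<close>, which only flips the sign of the sine.\<close>

lemma tp_window:
  assumes "quasi_periodic y"
  shows "tp y t = (\<Prod>i\<in>{k..<k+N}. \<bar>sin ((t - y i) / 2)\<bar> powr r i)"
proof -
  have "\<bar>sin ((t - y (i + N)) / 2)\<bar> = \<bar>sin ((t - y i) / 2)\<bar>" for i
  proof -
    have "(t - y (i + N)) / 2 = (t - y i) / 2 - pi"
      using assms by (simp add: quasi_periodic_def diff_divide_distrib add_divide_distrib)
    then show ?thesis by (simp only: sin_minus_pi abs_minus)
  qed
  then show ?thesis
    unfolding tp_def by (subst prod_periodic_window[where k = k]) (auto simp: r_periodic N_pos)
qed

lemma tp_periodic: "tp y (t + 2*pi) = tp y t"
proof -
  have "\<bar>sin ((t + 2*pi - x) / 2)\<bar> = \<bar>sin ((t - x) / 2)\<bar>" for x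
  proof -
    have "(t + 2*pi - x) / 2 = (t - x) / 2 + pi" by (simp add: field_simps)
    then show ?thesis by (simp only: sin_periodic_pi abs_minus)
  qed
  then show ?thesis unfolding tp_def by simp
qed

lemma tp_nonneg: "tp y t \<ge> 0"
  unfolding tp_def by (intro prod_nonneg) auto

text \<open>The nodes may depend on the parameter because widening an arc calls for joint continuity
  in displacement and point. Positivity of the weights gives continuity of the powers where a sine
  vanishes.\<close>

lemma continuous_on_tp:
  fixes Y :: "'a :: t2_space \<Rightarrow> int \<Rightarrow> real"
  assumes "\<And>i. continuous_on A (\<lambda>x. Y x i)" "continuous_on A f"
  shows "continuous_on A (\<lambda>x. tp (Y x) (f x))"
  unfolding tp_def
  by (intro continuous_on_prod continuous_on_powr' continuous_intros assms ballI) (auto simp: r_pos)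

lemma continuous_tp: "continuous_on UNIV (tp y)"
  by (rule continuous_on_tp) (auto intro: continuous_intros)

lemmas tp_le_supnorm = supnorm_ge[OF tp_periodic continuous_tp tp_nonneg]
lemmas tp_attains_supnorm = supnorm_attained[OF tp_periodic continuous_tp tp_nonneg]

lemma tp_translate: "tp (\<lambda>i. y i + c) t = tp y (t - c)"
  unfolding tp_def by (simp add: algebra_simps)

lemma supnorm_tp_translate: "supnorm (tp (\<lambda>i. y i + c)) = supnorm (tp y)"
  by (rule supnorm_translate[OF tp_periodic continuous_tp tp_nonneg, of _ _ "-c"]) (simp add: tp_translate)

lemma tp_node:
  assumes "quasi_periodic y"
  shows "tp y (y k) = 0"
  unfolding tp_window[OF assms, of _ k] using N_pos by (intro prod_zero) (auto intro!: bexI[of _ k])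

text \<open>The zeros of all factors form a countable set, so some point avoids them. Together with
  \<open>tp_node\<close>, this keeps maximum points away from nodes.\<close>

lemma supnorm_tp_pos: "supnorm (tp y) > 0"
proof -
  define Z where "Z = (\<Union>i::int. \<Union>m::int. {y i + 2 * (of_int m * pi)})"
  have "countable Z" unfolding Z_def by auto
  moreover have "uncountable {0..1::real}" by (simp add: uncountable_closed_interval)
  ultimately obtain t where t: "t \<notin> Z" by (metis countable_subset subsetI)
  have "sin ((t - y i) / 2) \<noteq> 0" for i
  proof
    assume "sin ((t - y i) / 2) = 0"
    then obtain m :: int where "(t - y i) / 2 = of_int m * pi" using sin_zero_iff_int2 by blast
    then have "t = y i + 2 * (of_int m * pi)" by simp
    then show False using t unfolding Z_def by blast
  qed
  then have "tp y t > 0" unfolding tp_def by (intro prod_pos) auto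
  then show ?thesis using tp_le_supnorm[of y t] by linarith
qed

section \<open>Uniqueness of equioscillating nodes\<close>

text \<open>The sign of the right side tells how \<open>sin ((w-x)/2) / sin ((y-x)/2)\<close>
  changes from \<open>x = s\<close> to \<open>x = t\<close>: as long as the sines are positive, it
  decreases when \<open>w < y\<close> and \<open>s < t\<close>.\<close>

lemma sin_cross_identity:
  fixes w y s t :: real
  shows "sin ((w-s)/2) * sin ((y-t)/2) - sin ((w-t)/2) * sin ((y-s)/2) = sin ((y-w)/2) * sin ((t-s)/2)"
proof -
  have "sin (a-b) * sin (c-d) - sin (a-d) * sin (c-b) = sin (c-a) * sin (d-b)" for a b c d :: real
  proof -
    have "sin (a-b) * sin (c-d) - sin (a-d) * sin (c-b)
        = (sin c * cos a - cos c * sin a) * (sin d * cos b - cos d * sin b)"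
      unfolding sin_diff by algebra
    then show ?thesis by (simp add: sin_diff)
  qed
  from this[of "w/2" "s/2" "y/2" "t/2"] show ?thesis by (simp add: diff_divide_distrib)
qed

lemma sin_half_pos: "0 < x \<Longrightarrow> x < 2*pi \<Longrightarrow> sin (x/2) > 0" for x :: real
  by (rule sin_gt_zero) auto

lemma abs_sin_half_minus: "\<bar>sin ((a - b) / 2)\<bar> = \<bar>sin ((b - a) / 2)\<bar>" for a b :: real
proof -
  have "(a - b) / 2 = - ((b - a) / 2)" by (simp add: field_simps)
  then show ?thesis by (simp only: sin_minus abs_minus)
qed

text \<open>Each quotient of a factor of \<open>w\<close> by the matching factor of \<open>y\<close>
  is no larger at \<open>t\<close> than at \<open>s\<close>, and one is strictly smaller. This gives
  \<open>tp w t * tp y s < tp w s * tp y t\<close>, although the left side is the product of the two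
  norms.\<close>

lemma equioscillation_no_domination:
  assumes qy: "quasi_periodic y" and qw: "quasi_periodic w"
    and my: "strict_mono y" and mw: "strict_mono w"
    and eq: "y k = w k" and le: "\<And>i. w i \<le> y i" and ne: "w l < y l"
    and s: "y (k-1) < s" "s < y k" "tp y s = supnorm (tp y)"
    and t: "w k < t" "t < w (k+1)" "tp w t = supnorm (tp w)"
  shows False
proof -
  have yper: "y (i + N) = y i + 2*pi" and wper: "w (i + N) = w i + 2*pi" for i
    using qy qw by (auto simp: quasi_periodic_def)
  \<comment> \<open>The index \<open>k\<close> is split off because its factor \<open>c\<close> is
    common to both products. It therefore contributes \<open>c s * c t\<close> to either side of the
    final comparison.\<close>
  define W where "W = {k+1..<k+N}"
  have win: "{k..<k+N} = insert k W" "k \<notin> W" "finite W" using N_pos by (auto simp: W_def)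
  define c where "c = (\<lambda>x. \<bar>sin ((x - w k) / 2)\<bar> powr r k)"
  define Q where "Q = (\<lambda>v x. \<Prod>i\<in>W. \<bar>sin ((x - v i) / 2)\<bar> powr r i)"
  have Tw: "tp w x = c x * Q w x" and Ty: "tp y x = c x * Q y x" for x
    unfolding tp_window[OF qw, of x k] tp_window[OF qy, of x k] win(1) c_def Q_def
    using win(2,3) eq by simp_all
  have st: "s < t" using s t eq by linarith
  have rng: "0 < w i - s" "w i - s < 2*pi" "0 < y i - s" "y i - s < 2*pi"
      "0 < w i - t" "w i - t < 2*pi" "0 < y i - t" "y i - t < 2*pi" if "i \<in> W" for i
  proof -
    have "w (k+1) \<le> w i" using that mw by (auto simp: W_def strict_mono_less_eq)
    moreover have "y i \<le> y (k - 1 + N)" using that my by (auto simp: W_def strict_mono_less_eq)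
    ultimately show "0 < w i - s" "w i - s < 2*pi" "0 < y i - s" "y i - s < 2*pi"
      "0 < w i - t" "w i - t < 2*pi" "0 < y i - t" "y i - t < 2*pi"
      using yper[of "k-1"] le[of i] s t st by linarith+
  qed
  \<comment> \<open>\<open>l\<close> is moved into the window by a multiple of \<open>N\<close>. It
    cannot land on \<open>k\<close>, where the two systems agree.\<close>
  obtain l' where l': "l' \<in> W" "w l' < y l'"
  proof
    define l' where "l' = k + (l - k) mod N"
    have "(\<lambda>i. y i - w i) (k + (l - k) mod N + ((l - k) div N) * N) = (\<lambda>i. y i - w i) l'"
      unfolding l'_def by (rule periodic_shift_int) (simp add: yper wper)
    moreover have "k + (l - k) mod N + ((l - k) div N) * N = l" by simp
    ultimately have *: "y l' - w l' = y l - w l" by simp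
    then show "w l' < y l'" using ne by simp
    then have "l' \<noteq> k" using eq by auto
    moreover have "0 \<le> (l - k) mod N" "(l - k) mod N < N" using N_pos by simp_all
    ultimately show "l' \<in> W" unfolding W_def l'_def by auto
  qed
  have sts: "sin ((t - s) / 2) > 0"
    using st rng[OF l'(1)] by (intro sin_half_pos) auto
  have diff: "sin ((w i-s)/2) * sin ((y i-t)/2) = sin ((w i-t)/2) * sin ((y i-s)/2)
      + sin ((y i-w i)/2) * sin ((t-s)/2)" for i
    using sin_cross_identity[of "w i" s "y i" t] by simp
  have pos: "sin ((w i-s)/2) > 0" "sin ((w i-t)/2) > 0" "sin ((y i-s)/2) > 0" "sin ((y i-t)/2) > 0"
    if "i \<in> W" for i using rng[OF that] by (auto intro!: sin_half_pos)
  define A where "A = (\<lambda>i. (sin ((w i-t)/2) * sin ((y i-s)/2)) powr r i)"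
  define B where "B = (\<lambda>i. (sin ((w i-s)/2) * sin ((y i-t)/2)) powr r i)"
  have QA: "Q w t * Q y s = (\<Prod>i\<in>W. A i)" and QB: "Q w s * Q y t = (\<Prod>i\<in>W. B i)"
    unfolding Q_def A_def B_def prod.distrib[symmetric]
    using pos by (auto intro!: prod.cong simp: abs_sin_half_minus[of _ "y _"] abs_sin_half_minus[of _ "w _"] powr_mult abs_of_pos less_imp_le)
  have ywle: "sin ((y i - w i)/2) \<ge> 0" if "i \<in> W" for i
    using le[of i] rng[OF that] t by (intro sin_ge_zero) auto
  have AB: "A i \<le> B i" "A i > 0" if "i \<in> W" for i
    unfolding A_def B_def using pos[OF that] r_pos[of i] diff[of i] mult_nonneg_nonneg[OF ywle[OF that] less_imp_le[OF sts]]
    by (auto intro!: powr_mono2 less_imp_le[of _ "r i"])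
  have lt: "A l' < B l'"
  proof -
    have "sin ((y l' - w l')/2) > 0" using l' rng[OF l'(1)] t by (intro sin_half_pos) auto
    then show ?thesis
      unfolding A_def B_def using pos[OF l'(1)] r_pos[of l'] diff[of l'] sts by (auto intro!: powr_less_mono2)
  qed
  have "(\<Prod>i\<in>W. A i) < (\<Prod>i\<in>W. B i)"
    by (rule prod_mono_strict[where i = l']) (use l'(1) lt win(3) AB in \<open>auto intro: less_imp_le less_le_trans\<close>)
  moreover have "c s > 0" "c t > 0"
  proof -
    have "sin ((w k - s)/2) > 0"
      using s eq yper[of "k-1"] strict_mono_less_eq[OF my, of k "k - 1 + N"] N_pos by (intro sin_half_pos) auto
    then show "c s > 0" unfolding c_def abs_sin_half_minus[of s] by auto
    have "w (k+1) \<le> w (k + N)" using mw N_pos by (simp add: strict_mono_less_eq)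
    then have "sin ((t - w k)/2) > 0" using t wper[of k] by (intro sin_half_pos) auto
    then show "c t > 0" unfolding c_def by auto
  qed
  ultimately have "c s * c t * (Q w t * Q y s) < c s * c t * (Q w s * Q y t)"
    unfolding QA QB by simp
  then have "tp w t * tp y s < tp w s * tp y t" unfolding Tw Ty by (simp add: algebra_simps)
  moreover have "tp w s * tp y t \<le> tp w t * tp y s"
    unfolding s t by (intro mult_mono tp_le_supnorm tp_nonneg less_imp_le[OF supnorm_tp_pos])
  ultimately show False by simp
qed


text \<open>The strict inequalities force consecutive nodes to be distinct, and ranging over all
  integers includes the arc that closes the circle.\<close>

definition equioscillating :: "(int \<Rightarrow> real) \<Rightarrow> bool" where
  "equioscillating y \<longleftrightarrow> (\<forall>i. \<exists>t. y i < t \<and> t < y (i+1) \<and> tp y t = supnorm (tp y))"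

lemma equioscillating_strict_mono: "equioscillating y \<Longrightarrow> strict_mono y"
  by (intro strict_mono_int_step) (meson equioscillating_def less_trans)

lemma equioscillating_unique:
  assumes qy: "quasi_periodic y" and qw: "quasi_periodic w"
    and oy: "equioscillating y" and ow: "equioscillating w" and eq0: "y 0 = w 0"
  shows "y = w"
proof (rule ccontr)
  assume neq: "y \<noteq> w"
  define d where "d = (\<lambda>i. w i - y i)"
  have dper: "d (i + N) = d i" for i
    using qy qw by (simp add: d_def quasi_periodic_def)
  have ne: "d ` {0..<N} \<noteq> {}" using N_pos by auto
  obtain k where k: "d k = Max (d ` {0..<N})" using Max_in[OF _ ne] by fastforce
  \<comment> \<open>By periodicity of \<open>d\<close>, a maximum over one period is a maximum over
    all indices.\<close>
  have dk: "d i \<le> d k" for i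
    unfolding k periodic_mod_int[of d N i, OF dper, symmetric] using N_pos by (intro Max_ge) auto
  obtain l where l: "d l < d k"
  proof -
    have "\<exists>l. d l \<noteq> d k"
    proof (rule ccontr)
      assume "\<nexists>l. d l \<noteq> d k"
      then have "d i = d 0" for i by metis
      then have "y i = w i" for i using eq0 by (simp add: d_def)
      then show False using neq by auto
    qed
    then show thesis using that dk by (metis order_less_le)
  qed
  \<comment> \<open>This is \<open>y\<close> rotated so that it meets \<open>w\<close> at index
    \<open>k\<close>; maximality of \<open>d k\<close> puts every other node of \<open>z\<close> at
    or beyond that of \<open>w\<close>.\<close>
  define z where "z = (\<lambda>i. y i + d k)"
  obtain s where s: "y (k-1) < s" "s < y k" "tp y s = supnorm (tp y)"
    using oy unfolding equioscillating_def by (metis diff_add_cancel)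
  obtain t where t: "w k < t" "t < w (k+1)" "tp w t = supnorm (tp w)"
    using ow unfolding equioscillating_def by blast
  show False
  proof (rule equioscillation_no_domination[of z w k l "s + d k" t])
    show "quasi_periodic z" using qy by (simp add: z_def quasi_periodic_def)
    show "strict_mono z" using equioscillating_strict_mono[OF oy] by (simp add: z_def strict_mono_def)
    show "w i \<le> z i" for i using dk[of i] by (simp add: z_def d_def)
    show "w l < z l" using l by (simp add: z_def d_def)
    show "tp z (s + d k) = supnorm (tp z)"
      unfolding z_def supnorm_tp_translate tp_translate using s by simp
  qed (use qw equioscillating_strict_mono[OF ow] s t in \<open>auto simp: z_def d_def\<close>)
qed

section \<open>Widening an arc\<close>

text \<open>Combined with the monotonicity of \<open>cot\<close> below, this expresses the strict
  concavity of \<open>ln (sin (x/2))\<close>.\<close>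

lemma ln_sin_half_diff:
  fixes x y :: real
  assumes "0 < x" "x < y" "y < 2*pi"
  obtains z where "x < z" "z < y" "ln (sin (y/2)) - ln (sin (x/2)) = (y - x) * (cot (z/2) / 2)"
proof -
  have "((\<lambda>x. ln (sin (x/2))) has_real_derivative cot (z/2) / 2) (at z)" if "x \<le> z" "z \<le> y" for z
    using sin_half_pos[of z] that assms
    by (auto intro!: derivative_eq_intros simp: cot_def)
  from MVT2[OF assms(2) this] show thesis using that by blast
qed

lemma cot_half_strict_antimono:
  fixes x y :: real
  assumes "0 < x" "x < y" "y < 2*pi"
  shows "cot (y/2) < cot (x/2)"
proof -
  have "sin (x/2) > 0" "sin (y/2) > 0" "sin (y/2 - x/2) > 0"
    using assms sin_half_pos[of x] sin_half_pos[of y] sin_half_pos[of "y-x"]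
    by (auto simp: diff_divide_distrib)
  then show ?thesis unfolding sin_diff by (simp add: cot_def divide_less_eq less_divide_eq mult.commute)
qed

text \<open>Here \<open>v\<close> and \<open>u\<close> are the distances from a point outside the
  arc back to the left and right end nodes, with weights \<open>a\<close> and \<open>b\<close>.
  Displacements \<open>c/a\<close> and \<open>c/b\<close> make both logarithmic changes equal to
  \<open>c\<close> times a value of \<open>cot (x/2) / 2\<close>. The gain is evaluated beyond
  \<open>v\<close> and the loss before \<open>u\<close>, so the loss prevails.\<close>

lemma sin_powr_widen:
  fixes u v c a b :: real
  assumes "0 < c" "0 < a" "0 < b" "0 < u - c/b" "u \<le> v" "v + c/a < 2*pi"
  shows "sin ((v + c/a)/2) powr a * sin ((u - c/b)/2) powr b < sin (v/2) powr a * sin (u/2) powr b"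
proof -
  have ca: "c/a > 0" "c/b > 0" using assms by auto
  obtain \<xi> where \<xi>: "v < \<xi>" "\<xi> < v + c/a"
    "ln (sin ((v + c/a)/2)) - ln (sin (v/2)) = c/a * (cot (\<xi>/2) / 2)"
    using ln_sin_half_diff[of v "v + c/a"] assms ca by auto
  obtain \<eta> where \<eta>: "u - c/b < \<eta>" "\<eta> < u"
    "ln (sin (u/2)) - ln (sin ((u - c/b)/2)) = c/b * (cot (\<eta>/2) / 2)"
    using ln_sin_half_diff[of "u - c/b" u] assms ca by auto
  have "cot (\<xi>/2) < cot (\<eta>/2)"
    using \<xi> \<eta> assms by (intro cot_half_strict_antimono) auto
  then have "c * (cot (\<xi>/2) / 2) < c * (cot (\<eta>/2) / 2)" using assms by simp
  moreover have "a * ln (sin ((v + c/a)/2)) - a * ln (sin (v/2)) = c * (cot (\<xi>/2) / 2)"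
    using \<xi>(3) assms by (simp add: field_simps)
  moreover have "b * ln (sin (u/2)) - b * ln (sin ((u - c/b)/2)) = c * (cot (\<eta>/2) / 2)"
    using \<eta>(3) assms by (simp add: field_simps)
  ultimately have "a * ln (sin ((v + c/a)/2)) + b * ln (sin ((u - c/b)/2))
      < a * ln (sin (v/2)) + b * ln (sin (u/2))" by linarith
  moreover have "sin ((v + c/a)/2) > 0" "sin ((u - c/b)/2) > 0" "sin (v/2) > 0" "sin (u/2) > 0"
    by (rule sin_half_pos; use assms ca in linarith)+
  ultimately show ?thesis by (simp add: powr_def exp_add[symmetric])
qed

text \<open>Near the arc there is room below the norm, so continuity handles small displacements.
  Beyond the widened arc, \<open>sin_powr_widen\<close> shows that the two moved factors shrink in
  product.\<close>

lemma widen_arc_decreases_supnorm: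
  assumes q: "quasi_periodic y" and m: "mono y"
    and small: "\<And>t. y i \<le> t \<Longrightarrow> t \<le> y (i+1) \<Longrightarrow> tp y t < supnorm (tp y)"
  obtains y' where "quasi_periodic y'" "mono y'" "supnorm (tp y') < supnorm (tp y)"
proof -
  define M where "M = supnorm (tp y)"
  have yper: "y (i + N) = y i + 2*pi" for i using q by (auto simp: quasi_periodic_def)
  \<comment> \<open>\<open>p\<close> is the first index in the cluster of nodes coinciding with
    \<open>y i\<close>, so its node can move left without breaking the order. Searching back to
    \<open>i - N\<close> suffices, since that node is smaller by \<open>2*pi\<close>. Symmetrically,
    \<open>q\<close> below is the last index in the cluster of \<open>y (i+1)\<close>.\<close>
  obtain p where p: "p \<le> i" "y p = y i" "y (p-1) < y p"
  proof
    define P where "P = {j\<in>{i-N..i}. y j = y i}"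
    have P: "finite P" "P \<noteq> {}" using N_pos unfolding P_def by (auto intro: finite_subset[of _ "{_.._}"])
    from Min_in[OF P] have in_P: "Min P \<in> P" .
    then show "Min P \<le> i" "y (Min P) = y i" by (auto simp: P_def)
    have "Min P \<noteq> i - N" using in_P yper[of "i-N"] by (auto simp: P_def)
    then have "y (Min P - 1) \<noteq> y i"
      using in_P Min_le[OF P(1), of "Min P - 1"] by (auto simp: P_def)
    moreover have "y (Min P - 1) \<le> y (Min P)" using m by (simp add: monoD)
    ultimately show "y (Min P - 1) < y (Min P)" using in_P by (auto simp: P_def)
  qed
  obtain q where q: "i < q" "y q = y (i+1)" "y q < y (q+1)"
  proof
    define P where "P = {j\<in>{i+1..i+1+N}. y j = y (i+1)}"
    have P: "finite P" "P \<noteq> {}"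
      using N_pos unfolding P_def by (auto intro: finite_subset[of _ "{_.._}"] intro!: exI[of _ "i+1"])
    from Max_in[OF P] have in_P: "Max P \<in> P" .
    then show "i < Max P" "y (Max P) = y (i+1)" by (auto simp: P_def)
    have "Max P \<noteq> i + 1 + N" using in_P yper[of "i+1"] by (auto simp: P_def)
    then have "y (Max P + 1) \<noteq> y (i+1)"
      using in_P Max_ge[OF P(1), of "Max P + 1"] by (auto simp: P_def)
    moreover have "y (Max P) \<le> y (Max P + 1)" using m by (simp add: monoD)
    ultimately show "y (Max P) < y (Max P + 1)" using in_P by (auto simp: P_def)
  qed
  have small': "tp y t < M" if "y p \<le> t" "t \<le> y q" for t
    using small that p q by (auto simp: M_def)
  \<comment> \<open>An arc covering a full period would contain a maximum point. Hence
    \<open>p\<close> and \<open>q\<close> are different residues modulo \<open>N\<close>.\<close>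
  have "y q < y p + 2*pi"
  proof (rule ccontr)
    assume "\<not> y q < y p + 2*pi"
    then show False using tp_attains_supnorm[of "y p" y] small' by (force simp: M_def)
  qed
  then have "\<not> p + N \<le> q" using yper[of p] monoD[OF m, of "p+N" q] by auto
  then have pq: "p < q" "q < p + N" using p q by auto
  \<comment> \<open>The direction of displacement, inversely proportional to the weights; testing
    residues makes it periodic, so that the perturbed nodes stay quasi-periodic.\<close>
  define e where "e = (\<lambda>j. if (j - p) mod N = 0 then - (1 / r p) else if (j - q) mod N = 0 then 1 / r q else 0)"
  have eper: "e (j + N) = e j" for j
  proof -
    have "(j + N - k) mod N = (j - k) mod N" for k
      using mod_add_self2[of "j - k" N] by (simp add: algebra_simps)
    then show ?thesis unfolding e_def by simp
  qed
  have e_p: "e p = - (1 / r p)" by (simp add: e_def)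
  have e_q: "e q = 1 / r q" using pq by (auto simp: e_def mod_pos_pos_trivial)
  have e_0: "e j = 0" if "j \<in> {p..<p+N} - {p,q}" for j
  proof -
    have "(j - p) mod N \<noteq> 0" using that by (auto simp: mod_pos_pos_trivial)
    moreover have "(j - q) mod N \<noteq> 0"
    proof
      assume "(j - q) mod N = 0"
      then have "N dvd (j - q)" by auto
      moreover have "\<bar>j - q\<bar> < N" "j - q \<noteq> 0" using that pq by auto
      ultimately show False using zdvd_not_zless[of "\<bar>j - q\<bar>" N] by auto
    qed
    ultimately show ?thesis by (simp add: e_def)
  qed
  define Y where "Y = (\<lambda>c j. y j + c * e j)"
  have qY: "quasi_periodic (Y c)" for c
    unfolding quasi_periodic_def Y_def by (simp add: yper eper)
  have "\<forall>\<^sub>F c in at_right 0. \<forall>j\<in>{p..<p+N}. Y c j \<le> Y c (j+1)"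
  proof (intro eventually_ball_finite ballI)
    fix j assume j: "j \<in> {p..<p+N}"
    show "\<forall>\<^sub>F c in at_right 0. Y c j \<le> Y c (j+1)"
    \<comment> \<open>A positive gap survives small displacements. If the nodes coincide,
      \<open>j\<close> is not \<open>q\<close>, which ends its cluster, and \<open>j + 1\<close> is
      not \<open>p + N\<close>, which begins one; so \<open>j\<close> does not move right and
      \<open>j + 1\<close> does not move left.\<close>
    proof (cases "y j < y (j+1)")
      case True
      have "((\<lambda>c. Y c (j+1) - Y c j) \<longlongrightarrow> (y (j+1) + 0 * e (j+1)) - (y j + 0 * e j)) (at_right 0)"
        unfolding Y_def by (intro tendsto_intros)
      then have "\<forall>\<^sub>F c in at_right 0. Y c (j+1) - Y c j > 0"
        using True by (intro order_tendstoD(1)) auto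
      then show ?thesis by eventually_elim simp
    next
      case False
      have "e j \<le> e (j+1)"
      proof -
        have "j \<noteq> q" using False q by auto
        then have "e j \<le> 0" using e_0[of j] e_p j r_pos[of p] by (cases "j = p") auto
        moreover have "e (j+1) \<ge> 0"
        proof (cases "j + 1 = p + N")
          case True
          then have "y (p - 1 + N) < y (p + N)" unfolding yper using p by simp
          moreover have "p - 1 + N = j" using True by simp
          ultimately show ?thesis using False True by simp
        next
          case F: False
          then show ?thesis
            using e_0[of "j+1"] e_q j r_pos[of q] by (cases "j + 1 = q") auto
        qed
        ultimately show ?thesis by simp
      qed
      moreover have "y j \<le> y (j+1)" using m by (simp add: monoD)
      ultimately have "\<And>c. c > 0 \<Longrightarrow> Y c j \<le> Y c (j+1)"
        unfolding Y_def by (intro add_mono mult_left_mono) auto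
      then show ?thesis by (auto simp: eventually_at_right_less intro: eventually_mono[OF eventually_at_right_less])
    qed
  qed simp
  moreover
  obtain \<epsilon> where \<epsilon>: "\<epsilon> > 0" "\<And>c t s. y p \<le> s \<Longrightarrow> s \<le> y q \<Longrightarrow> \<bar>c\<bar> + \<bar>t - s\<bar> < \<epsilon> \<Longrightarrow> tp (Y c) t < M"
  proof -
    \<comment> \<open>In the plane of pairs (displacement, point), the compact segment over the arc
      at displacement 0 lies in the open set \<open>U\<close>, so a uniform neighbourhood of it does
      too.\<close>
    define U where "U = {x. tp (Y (fst x)) (snd x) < M}"
    have "continuous_on UNIV (\<lambda>x. tp (Y (fst x)) (snd x))"
      unfolding Y_def by (intro continuous_on_tp continuous_intros)
    then have "open U" unfolding U_def by (intro open_Collect_less continuous_intros)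
    moreover have "compact ({0} \<times> {y p..y q})" by (intro compact_Times) auto
    moreover have "{0} \<times> {y p..y q} \<subseteq> U" unfolding U_def Y_def using small' by auto
    ultimately obtain \<epsilon> where \<epsilon>: "\<epsilon> > 0" "(\<Union>x\<in>{0} \<times> {y p..y q}. ball x \<epsilon>) \<subseteq> U"
      using compact_subset_open_imp_ball_epsilon_subset by metis
    show thesis
    proof (rule that[OF \<epsilon>(1)])
      fix c t s assume *: "y p \<le> s" "s \<le> y q" "\<bar>c\<bar> + \<bar>t - s\<bar> < \<epsilon>"
      have "dist (0, s) (c, t) \<le> \<bar>c\<bar> + \<bar>t - s\<bar>"
        unfolding dist_Pair_Pair dist_real_def
        using sqrt_sum_squares_le_sum_abs[of "0 - c" "s - t"] by (simp add: abs_minus_commute)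
      then have "(c, t) \<in> ball (0, s) \<epsilon>" using * by simp
      then have "(c, t) \<in> U" using \<epsilon>(2) * by fastforce
      then show "tp (Y c) t < M" by (simp add: U_def)
    qed
  qed
  have "\<forall>\<^sub>F c in at_right 0. c + c / r p < \<epsilon> \<and> c + c / r q < \<epsilon>"
  proof (rule eventually_conj)
    have "((\<lambda>c. c + c / r j) \<longlongrightarrow> 0 + 0 / r j) (at_right 0)" for j
      using r_pos[of j] by (intro tendsto_intros) auto
    then show "\<forall>\<^sub>F c in at_right 0. c + c / r p < \<epsilon>" "\<forall>\<^sub>F c in at_right 0. c + c / r q < \<epsilon>"
      using \<epsilon>(1) by (auto intro!: order_tendstoD(2))
  qed
  moreover have "\<forall>\<^sub>F c in at_right 0. (0::real) < c" by (rule eventually_at_right_less)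
  ultimately have "\<forall>\<^sub>F c in at_right 0. (\<forall>j\<in>{p..<p+N}. Y c j \<le> Y c (j+1)) \<and>
      c + c / r p < \<epsilon> \<and> c + c / r q < \<epsilon> \<and> 0 < c"
    by eventually_elim auto
  from eventually_happens'[OF trivial_limit_at_right_real this]
  obtain c where c: "\<And>j. j \<in> {p..<p+N} \<Longrightarrow> Y c j \<le> Y c (j+1)"
      "c + c / r p < \<epsilon>" "c + c / r q < \<epsilon>" "0 < c"
    by blast
  have mY: "mono (Y c)"
  proof -
    have "Y c j \<le> Y c (j+1)" for j
    proof -
      define g where "g = (\<lambda>j. Y c (j+1) - Y c j)"
      have gper: "g (j + N) = g j" for j
        unfolding g_def Y_def using yper[of j] yper[of "j+1"] eper[of j] eper[of "j+1"]
        by (simp add: algebra_simps)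
      have "g (p + (j - p) mod N + (j - p) div N * N) = g (p + (j - p) mod N)"
        by (rule periodic_shift_int) (rule gper)
      then have "g j = g (p + (j - p) mod N)" by simp
      then show ?thesis using c(1)[of "p + (j - p) mod N"] N_pos by (simp add: g_def)
    qed
    then show ?thesis by (rule mono_int_step)
  qed
  have "tp (Y c) t < M" for t
  proof -
    \<comment> \<open>The period is taken to start at the moved left end \<open>y p - a\<close>. It
      then splits into the widened arc, up to \<open>y q + b\<close>, and the points beyond
      it.\<close>
    define a b where "a = c / r p" and "b = c / r q"
    have ab: "a > 0" "b > 0" using c(4) r_pos by (auto simp: a_def b_def)
    obtain t' where t': "y p - a \<le> t'" "t' < y p - a + 2*pi" "tp (Y c) t' = tp (Y c) t"
      using periodic_representative[of "tp (Y c)" "y p - a" t] tp_periodic by blast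
    have "tp (Y c) t' < M"
    proof (cases "t' \<le> y q + b")
      case True
      \<comment> \<open>The point of the original arc nearest to \<open>t'\<close>, at distance at
        most \<open>a\<close> or \<open>b\<close>.\<close>
      define s where "s = max (y p) (min (y q) t')"
      have "y p \<le> y q" using pq m by (simp add: monoD)
      then show ?thesis using c t' True ab by (intro \<epsilon>(2)[of s]) (auto simp: s_def a_def b_def)
    next
      case False
      define G where "G = (\<Prod>j\<in>{p..<p+N} - {p,q}. \<bar>sin ((t' - y j) / 2)\<bar> powr r j)"
      have win: "{p..<p+N} = insert p (insert q ({p..<p+N} - {p,q}))" using pq by auto
      have G1: "tp y t' = \<bar>sin ((t' - y p) / 2)\<bar> powr r p * \<bar>sin ((t' - y q) / 2)\<bar> powr r q * G"
        unfolding tp_window[OF \<open>quasi_periodic y\<close>, of _ p] G_def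
        by (subst win) (use pq in simp)
      have rest: "(\<Prod>j\<in>{p..<p+N} - {p,q}. \<bar>sin ((t' - Y c j) / 2)\<bar> powr r j) = G"
        unfolding G_def by (intro prod.cong) (use e_0 in \<open>auto simp: Y_def\<close>)
      have ends: "t' - Y c p = t' - y p + a" "t' - Y c q = t' - y q - b" by (auto simp: Y_def e_p e_q a_def b_def)
      have G2: "tp (Y c) t' = \<bar>sin ((t' - y p + a) / 2)\<bar> powr r p * \<bar>sin ((t' - y q - b) / 2)\<bar> powr r q * G"
        unfolding tp_window[OF qY, of _ _ p]
        by (subst win) (use pq in \<open>simp add: rest ends\<close>)
      have "y p \<le> y q" using pq m by (simp add: monoD)
      then have "sin ((t' - y p + a)/2) > 0" "sin ((t' - y q - b)/2) > 0" "sin ((t' - y p)/2) > 0" "sin ((t' - y q)/2) > 0"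
        using False t' ab by (auto intro!: sin_half_pos)
      moreover have "sin ((t' - y p + c / r p)/2) powr r p * sin ((t' - y q - c / r q)/2) powr r q
          < sin ((t' - y p)/2) powr r p * sin ((t' - y q)/2) powr r q"
        using \<open>y p \<le> y q\<close> False t' ab c(4) r_pos by (intro sin_powr_widen) (auto simp: a_def b_def)
      ultimately have lt: "\<bar>sin ((t' - y p + a) / 2)\<bar> powr r p * \<bar>sin ((t' - y q - b) / 2)\<bar> powr r q
          < \<bar>sin ((t' - y p) / 2)\<bar> powr r p * \<bar>sin ((t' - y q) / 2)\<bar> powr r q"
        unfolding a_def b_def by simp
      have "G \<ge> 0" unfolding G_def by (intro prod_nonneg) auto
      \<comment> \<open>At an unmoved node \<open>G\<close> vanishes and the comparison of the moved
        factors is lost, but then the new product is 0, which is below \<open>M\<close>.\<close>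
      then consider "G = 0" | "G > 0" by linarith
      then show ?thesis
      proof cases
        case 1
        then show ?thesis using G2 supnorm_tp_pos[of y] by (simp add: M_def)
      next
        case 2
        then have "tp (Y c) t' < tp y t'" unfolding G1 G2 using lt by simp
        also have "\<dots> \<le> M" unfolding M_def by (rule tp_le_supnorm)
        finally show ?thesis .
      qed
    qed
    then show ?thesis using t' by simp
  qed
  \<comment> \<open>The new norm is attained, so the strict pointwise bound carries over to
    it.\<close>
  moreover obtain t where "tp (Y c) t = supnorm (tp (Y c))" using tp_attains_supnorm by blast
  ultimately have "supnorm (tp (Y c)) < M" by metis
  then show thesis using that[OF qY mY] by (simp add: M_def)
qed

text \<open>Widening shows that every closed arc carries a maximum point. The product vanishes at
  nodes while the norm is positive, so this point is interior and no arc is degenerate.\<close>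

lemma minimal_equioscillating:
  assumes q: "quasi_periodic y" and "mono y"
    and min: "\<And>y'. quasi_periodic y' \<Longrightarrow> mono y' \<Longrightarrow> supnorm (tp y) \<le> supnorm (tp y')"
  shows "equioscillating y"
  unfolding equioscillating_def
proof
  fix i
  have "\<exists>t. y i \<le> t \<and> t \<le> y (i+1) \<and> \<not> tp y t < supnorm (tp y)"
  proof (rule ccontr)
    assume "\<not> ?thesis"
    then obtain y' where "quasi_periodic y'" "mono y'" "supnorm (tp y') < supnorm (tp y)"
      using widen_arc_decreases_supnorm[OF assms(1,2), of i] by blast
    then show False using min[of y'] by simp
  qed
  then obtain t where t: "y i \<le> t" "t \<le> y (i+1)" "tp y t = supnorm (tp y)"
    using tp_le_supnorm[of y] by (meson antisym_conv1)
  then have "t \<noteq> y i" "t \<noteq> y (i+1)"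
    using supnorm_tp_pos[of y] tp_node[OF q] by auto
  then show "\<exists>t. y i < t \<and> t < y (i+1) \<and> tp y t = supnorm (tp y)" using t by (auto simp: order_less_le)
qed

end

section \<open>Node lists\<close>

definition cyclic_ext :: "nat \<Rightarrow> real list \<Rightarrow> int \<Rightarrow> real" where
  "cyclic_ext n ys i = ys ! nat (i mod int (Suc n)) + 2*pi * of_int (i div int (Suc n))"

lemma nat_mod_Suc_le: "nat (i mod int (Suc n)) \<le> n"
  using pos_mod_bound[of "int (Suc n)" i] by linarith

lemma cyclic_ext_nth: "j \<le> n \<Longrightarrow> cyclic_ext n ys (int j) = ys ! j"
  by (simp add: cyclic_ext_def flip: of_nat_Suc)

lemma cyclic_ext_shift: "cyclic_ext n ys (i + int (Suc n)) = cyclic_ext n ys i + 2*pi"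
proof -
  have "(i + int (Suc n)) div int (Suc n) = i div int (Suc n) + 1"
    "(i + int (Suc n)) mod int (Suc n) = i mod int (Suc n)"
    by (subst div_add_self2) (auto simp del: of_nat_Suc)
  then show ?thesis unfolding cyclic_ext_def by (simp add: algebra_simps del: of_nat_Suc)
qed

lemma cyclic_ext_last: "cyclic_ext n ys (int n + 1) = ys ! 0 + 2*pi"
  using cyclic_ext_shift[of n ys 0] cyclic_ext_nth[of 0 n ys] by (simp add: algebra_simps)

lemma mono_cyclic_ext:
  assumes "admissible n ys"
  shows "mono (cyclic_ext n ys)"
proof (rule mono_int_step)
  fix i
  define g where "g = (\<lambda>i. cyclic_ext n ys (i + 1) - cyclic_ext n ys i)"
  have gper: "g (i + int (Suc n)) = g i" for i
    using cyclic_ext_shift[of n ys i] cyclic_ext_shift[of n ys "i+1"] by (simp add: g_def algebra_simps)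
  define j where "j = nat (i mod int (Suc n))"
  have j: "j \<le> n" "i mod int (Suc n) = int j"
    unfolding j_def using nat_mod_Suc_le by (simp_all del: of_nat_Suc)
  \<comment> \<open>Gaps are periodic, so one period suffices. At \<open>j = n\<close> the next node
    is \<open>2*pi\<close>, and the bound on the last node of an admissible list applies.\<close>
  have "g (int j) \<ge> 0"
  proof (cases "j = n")
    case True
    then show ?thesis
      using assms cyclic_ext_last[of n ys] cyclic_ext_nth[of n n ys] by (simp add: g_def admissible_def)
  next
    case False
    then show ?thesis
      using assms j cyclic_ext_nth[of "Suc j" n ys] cyclic_ext_nth[of j n ys]
      by (simp add: g_def admissible_def add.commute)
  qed
  then have "g i \<ge> 0" using periodic_mod_int[of g "int (Suc n)" i, OF gper] j by simp
  then show "cyclic_ext n ys i \<le> cyclic_ext n ys (i + 1)" by (simp add: g_def)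
qed

lemma strict_nodes_admissible: "strict_nodes n ys \<Longrightarrow> admissible n ys"
  by (auto simp: strict_nodes_def admissible_def less_imp_le)

text \<open>Bolzano-Weierstrass one coordinate at a time, refining the subsequence at each step of
  the induction.\<close>

lemma bounded_coordinates_convergent_subseq:
  fixes f :: "nat \<Rightarrow> nat \<Rightarrow> real"
  assumes "\<And>k j. j < n \<Longrightarrow> \<bar>f k j\<bar> \<le> B"
  shows "\<exists>s L. strict_mono s \<and> (\<forall>j<n. (\<lambda>k. f (s k) j) \<longlonglongrightarrow> L j)"
  using assms
proof (induction n)
  case 0
  show ?case by (auto intro: strict_mono_id)
next
  case (Suc n)
  then obtain s L where s: "strict_mono s" "\<And>j. j < n \<Longrightarrow> (\<lambda>k. f (s k) j) \<longlonglongrightarrow> L j"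
    by (metis less_SucI)
  have "bounded (range (\<lambda>k. f (s k) n))"
    using Suc.prems[of n] by (auto simp: bounded_real intro!: exI[of _ B])
  then obtain l s' where s': "strict_mono (s' :: nat \<Rightarrow> nat)" "((\<lambda>k. f (s k) n) \<circ> s') \<longlonglongrightarrow> l"
    using bounded_imp_convergent_subsequence by blast
  have "(\<lambda>k. f ((s \<circ> s') k) j) \<longlonglongrightarrow> (L(n := l)) j" if "j < Suc n" for j
    using LIMSEQ_subseq_LIMSEQ[OF s(2) s'(1), of j] s'(2) that by (cases "j = n") (auto simp: o_def)
  then show ?case using strict_mono_o[OF s(1) s'(1)] by blast
qed

section \<open>Passage between node lists and periodic sequences\<close>

context
  fixes n :: nat and r :: "nat \<Rightarrow> real"
  assumes weights_pos: "\<forall>j\<le>n. r j > 0"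
begin

interpretation periodic_weights "int (Suc n)" "\<lambda>i. r (nat (i mod int (Suc n)))"
proof
  show "0 < r (nat (i mod int (Suc n)))" for i
    using weights_pos nat_mod_Suc_le by blast
qed auto

lemma gtp_eq_tp:
  assumes "length ys = Suc n" "\<And>j. j \<le> n \<Longrightarrow> ys ! j = y (int j) + c"
  shows "gtp r ys t = tp y (t - c)"
  unfolding gtp_def tp_def assms(1)
  by (rule prod.reindex_bij_witness[of _ nat int]) (auto simp: assms(2) algebra_simps simp flip: of_nat_Suc)

lemma gtp_eq_tp_cyclic_ext:
  assumes "length ys = Suc n"
  shows "gtp r ys = tp (cyclic_ext n ys)"
  using gtp_eq_tp[OF assms, of "cyclic_ext n ys" 0] by (auto simp: cyclic_ext_nth)

lemma quasi_periodic_cyclic_ext: "quasi_periodic (cyclic_ext n ys)"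
  unfolding quasi_periodic_def using cyclic_ext_shift by blast

text \<open>Rotating node 0 to the origin preserves the norm. Minimality among lists thus implies
  minimality among all monotone quasi-periodic sequences.\<close>

lemma admissible_of_quasi_periodic:
  assumes q: "quasi_periodic y" and m: "mono y"
  obtains ys where "admissible n ys" "supnorm (gtp r ys) = supnorm (tp y)"
proof
  define ys where "ys = map (\<lambda>j. y (int j) - y 0) [0..<Suc n]"
  have nth: "ys ! j = y (int j) - y 0" if "j \<le> n" for j
    using that unfolding ys_def by (simp del: upt_Suc)
  have len: "length ys = Suc n" by (simp add: ys_def)
  have "y (int n) \<le> y (0 + int (Suc n))" by (rule monoD[OF m]) simp
  also have "\<dots> = y 0 + 2*pi" using q unfolding quasi_periodic_def by blast
  finally show "admissible n ys"
    using m len by (auto simp: admissible_def nth monoD)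
  have "gtp r ys t = tp y (t + y 0)" for t
    using gtp_eq_tp[OF len, of y "- y 0"] nth by simp
  then show "supnorm (gtp r ys) = supnorm (tp y)"
    by (rule supnorm_translate[OF tp_periodic continuous_tp tp_nonneg])
qed

section \<open>Existence of a minimizer\<close>

lemma supnorm_gtp_nonneg: "admissible n ys \<Longrightarrow> supnorm (gtp r ys) \<ge> 0"
  using supnorm_tp_pos by (simp add: gtp_eq_tp_cyclic_ext admissible_def less_imp_le)

lemma min_norm_le: "admissible n ys \<Longrightarrow> min_norm r n \<le> supnorm (gtp r ys)"
  unfolding min_norm_def using supnorm_gtp_nonneg by (intro cINF_lower bdd_belowI2[of _ 0]) auto

text \<open>A minimizing sequence has a subsequence converging in every coordinate, and the weak
  inequalities of \<open>admissible\<close> pass to the limit.\<close>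

lemma min_norm_attained: "\<exists>ys. admissible n ys \<and> supnorm (gtp r ys) = min_norm r n"
proof -
  have "admissible n (replicate (Suc n) 0)"
    by (auto simp: admissible_def nth_Cons' simp del: replicate_Suc)
  then have ne: "{ys. admissible n ys} \<noteq> {}" by blast
  have "\<exists>ys. admissible n ys \<and> supnorm (gtp r ys) < min_norm r n + 1 / real (Suc k)" for k
    using cInf_lessD[of "(\<lambda>ys. supnorm (gtp r ys)) ` {ys. admissible n ys}" "min_norm r n + 1 / real (Suc k)"] ne
    unfolding min_norm_def by auto
  then obtain Y where Y: "\<And>k. admissible n (Y k)" "\<And>k. supnorm (gtp r (Y k)) < min_norm r n + 1 / real (Suc k)"
    by metis
  have "\<bar>Y k ! j\<bar> \<le> 2*pi" if "j < Suc n" for k j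
  proof -
    have m: "mono (cyclic_ext n (Y k))" by (rule mono_cyclic_ext[OF Y(1)])
    have "cyclic_ext n (Y k) (int 0) \<le> cyclic_ext n (Y k) (int j)"
      "cyclic_ext n (Y k) (int j) \<le> cyclic_ext n (Y k) (int n)"
      using that by (auto intro: monoD[OF m])
    then show ?thesis using Y(1)[of k] that unfolding admissible_def by (subst (asm) (1 2 3 4) cyclic_ext_nth) auto
  qed
  from bounded_coordinates_convergent_subseq[of "Suc n" "\<lambda>k j. Y k ! j", OF this]
  obtain s L where s: "strict_mono s" and L: "\<And>j. j \<le> n \<Longrightarrow> (\<lambda>k. Y (s k) ! j) \<longlonglongrightarrow> L j"
    by (auto simp: less_Suc_eq_le)
  define ys where "ys = map L [0..<Suc n]"
  have nth: "ys ! j = L j" if "j \<le> n" for j using that unfolding ys_def by (simp del: upt_Suc)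
  have len: "length ys = Suc n" by (simp add: ys_def)
  have adm: "admissible n ys"
    unfolding admissible_def
  proof (intro conjI allI impI len)
    have "(\<lambda>k. Y (s k) ! 0) \<longlonglongrightarrow> 0" using Y(1) by (simp add: admissible_def)
    then show "ys ! 0 = 0" using L[of 0] nth[of 0] LIMSEQ_unique by simp blast
    show "ys ! n \<le> 2*pi"
      unfolding nth[OF order_refl] by (rule LIMSEQ_le_const2[OF L]) (use Y(1) in \<open>auto simp: admissible_def\<close>)
    fix j assume "j < n"
    then show "ys ! j \<le> ys ! Suc j"
      using LIMSEQ_le[OF L[of j] L[of "Suc j"]] Y(1) nth by (auto simp: admissible_def)
  qed
  \<comment> \<open>A pointwise limit at fixed \<open>t\<close> is enough, because the norm of the
    limit is attained at some point.\<close>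
  have "gtp r ys t \<le> min_norm r n" for t
  proof (rule LIMSEQ_le)
    have "(\<lambda>k. \<Prod>j<Suc n. \<bar>sin ((t - Y (s k) ! j) / 2)\<bar> powr r j)
        \<longlonglongrightarrow> (\<Prod>j<Suc n. \<bar>sin ((t - L j) / 2)\<bar> powr r j)"
      using weights_pos by (intro tendsto_prod tendsto_powr' tendsto_intros L) auto
    moreover have "length (Y (s k)) = Suc n" for k using Y(1) by (simp add: admissible_def)
    ultimately show "(\<lambda>k. gtp r (Y (s k)) t) \<longlonglongrightarrow> gtp r ys t"
      unfolding gtp_def len using nth by (simp add: less_Suc_eq_le del: prod.lessThan_Suc cong: prod.cong_simp)
    have "(\<lambda>k. min_norm r n + 1 / real (Suc (s k))) \<longlonglongrightarrow> min_norm r n + 0"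
      using LIMSEQ_subseq_LIMSEQ[OF LIMSEQ_inverse_real_of_nat s]
      by (intro tendsto_intros) (simp add: o_def inverse_eq_divide)
    then show "(\<lambda>k. min_norm r n + 1 / real (Suc (s k))) \<longlonglongrightarrow> min_norm r n" by simp
    have "gtp r (Y k) t \<le> min_norm r n + 1 / real (Suc k)" for k
    proof -
      have "gtp r (Y k) t \<le> supnorm (gtp r (Y k))"
        using Y(1)[of k] tp_le_supnorm by (simp add: gtp_eq_tp_cyclic_ext admissible_def)
      then show ?thesis using Y(2)[of k] by linarith
    qed
    then show "\<exists>K. \<forall>k\<ge>K. gtp r (Y (s k)) t \<le> min_norm r n + 1 / real (Suc (s k))" by blast
  qed
  then have "supnorm (gtp r ys) \<le> min_norm r n"
    using tp_attains_supnorm[of 0 "cyclic_ext n ys"] unfolding gtp_eq_tp_cyclic_ext[OF len] by metis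
  then show ?thesis using min_norm_le[OF adm] adm by (intro exI[of _ ys]) auto
qed

section \<open>Equioscillation and interlacing for node lists\<close>

lemma min_norm_equioscillating:
  assumes adm: "admissible n ys" and min: "supnorm (gtp r ys) = min_norm r n"
  shows "equioscillating (cyclic_ext n ys)"
proof (rule minimal_equioscillating[OF quasi_periodic_cyclic_ext mono_cyclic_ext[OF adm]])
  fix y' assume "quasi_periodic y'" "mono y'"
  then obtain ys' where "admissible n ys'" "supnorm (gtp r ys') = supnorm (tp y')"
    using admissible_of_quasi_periodic by blast
  then show "supnorm (tp (cyclic_ext n ys)) \<le> supnorm (tp y')"
    using min_norm_le[of ys'] min adm by (simp add: gtp_eq_tp_cyclic_ext admissible_def)
qed

lemma equioscillating_strict_nodes:
  assumes adm: "admissible n ys" and osc: "equioscillating (cyclic_ext n ys)"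
  shows "strict_nodes n ys"
proof -
  note m = equioscillating_strict_mono[OF osc]
  have "ys ! j < ys ! Suc j" if "j < n" for j
    using strict_monoD[OF m, of "int j" "int (Suc j)"] that by (simp add: cyclic_ext_nth del: of_nat_Suc)
  moreover have "ys ! n < 2*pi"
    using strict_monoD[OF m, of "int n" "int n + 1"] adm
    by (simp add: cyclic_ext_nth cyclic_ext_last admissible_def)
  ultimately show ?thesis using adm by (simp add: strict_nodes_def admissible_def)
qed

lemma equioscillating_eq:
  assumes "admissible n ys" "admissible n ws"
    and "equioscillating (cyclic_ext n ys)" "equioscillating (cyclic_ext n ws)"
  shows "ys = ws"
proof -
  have "cyclic_ext n ys = cyclic_ext n ws"
    using assms cyclic_ext_nth[of 0 n]
    by (intro equioscillating_unique quasi_periodic_cyclic_ext) (auto simp: admissible_def)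
  then show ?thesis
    using assms(1,2) cyclic_ext_nth[of _ n] by (intro nth_equalityI) (auto simp: admissible_def less_Suc_eq_le, metis)
qed

lemma equioscillating_iff_interlacing:
  assumes adm: "admissible n ws"
  shows "equioscillating (cyclic_ext n ws) \<longleftrightarrow>
    (\<exists>zs. interlacing n ws zs \<and> (\<forall>j\<le>n. gtp r ws (zs ! j) = supnorm (gtp r ws)))"
proof -
  define y where "y = cyclic_ext n ws"
  have gtp: "gtp r ws = tp y" unfolding y_def using adm by (simp add: gtp_eq_tp_cyclic_ext admissible_def)
  have nth: "y (int j) = ws ! j" if "j \<le> n" for j using that by (simp add: y_def cyclic_ext_nth)
  have last: "y (int n + 1) = 2*pi" using adm by (simp add: y_def cyclic_ext_last admissible_def)
  show ?thesis
    unfolding y_def[symmetric] gtp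
  proof
    assume "equioscillating y"
    then obtain z where z: "\<And>i. y i < z i" "\<And>i. z i < y (i+1)" "\<And>i. tp y (z i) = supnorm (tp y)"
      unfolding equioscillating_def by metis
    define zs where "zs = map (\<lambda>j. z (int j)) [0..<Suc n]"
    have zs: "zs ! j = z (int j)" if "j \<le> n" for j using that unfolding zs_def by (simp del: upt_Suc)
    have "zs ! j < ws ! Suc j" if "j < n" for j
      using z(2)[of "int j"] nth[of "Suc j"] zs[of j] that by (simp add: add.commute)
    moreover have "ws ! j < zs ! j" if "j \<le> n" for j using z(1)[of "int j"] nth zs that by simp
    moreover have "zs ! n < 2*pi" using z(2)[of "int n"] last zs by simp
    ultimately have "interlacing n ws zs" by (simp add: interlacing_def zs_def)
    then show "\<exists>zs. interlacing n ws zs \<and> (\<forall>j\<le>n. tp y (zs ! j) = supnorm (tp y))"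
      using zs z(3) by auto
  next
    assume "\<exists>zs. interlacing n ws zs \<and> (\<forall>j\<le>n. tp y (zs ! j) = supnorm (tp y))"
    then obtain zs where zs: "interlacing n ws zs" "\<And>j. j \<le> n \<Longrightarrow> tp y (zs ! j) = supnorm (tp y)" by blast
    define P where "P = (\<lambda>i. \<exists>t. y i < t \<and> t < y (i+1) \<and> tp y t = supnorm (tp y))"
    \<comment> \<open>Translating a maximum point by \<open>2*pi\<close> carries it to the arc
      \<open>n + 1\<close> indices later, so the arcs with indices 0 to \<open>n\<close> represent
      all of them. The last of these ends at \<open>2*pi\<close>, which matches
      \<open>zs ! n < 2*pi\<close>.\<close>
    have per: "P (i + int (Suc n)) = P i" for i
    proof -
      have "y (i + int (Suc n)) = y i + 2*pi" "y (i + int (Suc n) + 1) = y (i + 1) + 2*pi"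
        unfolding y_def using cyclic_ext_shift[of n ws i] cyclic_ext_shift[of n ws "i+1"]
        by (simp_all add: algebra_simps)
      then have "P (i + int (Suc n)) \<longleftrightarrow> (\<exists>t. y i + 2*pi < t \<and> t < y (i+1) + 2*pi \<and> tp y t = supnorm (tp y))"
        unfolding P_def by simp
      also have "\<dots> \<longleftrightarrow> P i"
        unfolding P_def
      proof
        assume "\<exists>t. y i + 2*pi < t \<and> t < y (i+1) + 2*pi \<and> tp y t = supnorm (tp y)"
        then obtain t where "y i + 2*pi < t" "t < y (i+1) + 2*pi" "tp y t = supnorm (tp y)" by blast
        then show "\<exists>t. y i < t \<and> t < y (i+1) \<and> tp y t = supnorm (tp y)"
          using tp_periodic[of y "t - 2*pi"] by (intro exI[of _ "t - 2*pi"]) auto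
      next
        assume "\<exists>t. y i < t \<and> t < y (i+1) \<and> tp y t = supnorm (tp y)"
        then obtain t where "y i < t" "t < y (i+1)" "tp y t = supnorm (tp y)" by blast
        then show "\<exists>t. y i + 2*pi < t \<and> t < y (i+1) + 2*pi \<and> tp y t = supnorm (tp y)"
          using tp_periodic[of y t] by (intro exI[of _ "t + 2*pi"]) auto
      qed
      finally show ?thesis .
    qed
    have base: "P (int j)" if "j \<le> n" for j
    proof -
      have "y (int j) < zs ! j" using zs(1) that by (simp add: interlacing_def nth)
      moreover have "zs ! j < y (int j + 1)"
      proof (cases "j = n")
        case True
        then show ?thesis using zs(1) last by (simp add: interlacing_def)
      next
        case False
        then show ?thesis using zs(1) that nth[of "Suc j"] by (simp add: interlacing_def add.commute)
      qed
      ultimately show ?thesis using zs(2)[OF that] unfolding P_def by blast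
    qed
    have "P i" for i
    proof -
      have "P (i mod int (Suc n))"
        using base[OF nat_mod_Suc_le, of i] by (simp del: of_nat_Suc)
      then show ?thesis using periodic_mod_int[of P, OF per] by simp
    qed
    then show "equioscillating y" unfolding equioscillating_def P_def by blast
  qed
qed

text \<open>Any minimizer equioscillates, hence has strictly increasing nodes; two minimizers
  coincide because equioscillating lists are unique.\<close>

lemma exists_unique_minimal_nodes:
  "\<exists>!ws. strict_nodes n ws \<and> supnorm (gtp r ws) = min_norm r n"
  by (metis equioscillating_eq equioscillating_strict_nodes min_norm_attained min_norm_equioscillating
      strict_nodes_admissible)

text \<open>For the converse direction, an equioscillating list equals the minimizer provided by
  compactness, which equioscillates as well.\<close>

lemma minimal_nodes_iff_interlacing:
  assumes "strict_nodes n ws"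
  shows "supnorm (gtp r ws) = min_norm r n \<longleftrightarrow>
    (\<exists>zs. interlacing n ws zs \<and> (\<forall>j\<le>n. gtp r ws (zs ! j) = supnorm (gtp r ws)))"
  unfolding equioscillating_iff_interlacing[OF strict_nodes_admissible[OF assms], symmetric]
  by (metis assms equioscillating_eq min_norm_attained min_norm_equioscillating strict_nodes_admissible)

end

theorem theorem13p3:
  fixes n :: nat and r :: "nat \<Rightarrow> real"
  assumes "\<forall>j\<le>n. r j > 0"
  shows "(\<exists>!ws. strict_nodes n ws \<and> supnorm (gtp r ws) = min_norm r n)
    \<and> (\<forall>ws. strict_nodes n ws \<longrightarrow>
         (supnorm (gtp r ws) = min_norm r n \<longleftrightarrow>
          (\<exists>zs. interlacing n ws zs \<and>
                (\<forall>j\<le>n. gtp r ws (zs ! j) = supnorm (gtp r ws)))))"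
  using exists_unique_minimal_nodes[OF assms] minimal_nodes_iff_interlacing[OF assms] by blast

end
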